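(* Let $r>0$ be real, let $k_r$ be the singular modulus, $a(r)$ the elliptic alpha function, $\beta_r$ as in the context, and let $\alpha_5(r)=a_{1/3}(\sqrt{\beta_r})$ be the generalized elliptic alpha function of order $s=1/3$ at $x_r=\sqrt{\beta_r}$. Then $$10\,\alpha_5(r)\,r^{-1/2}=1+8\beta_r-\frac{1+k_r^2-3a(r)r^{-1/2}}{\sqrt{1-k_r^2+k_r^4}} .$$
   Context: $K(x)=\int_0^{\pi/2}\frac{dt}{\sqrt{1-x^2\sin^2 t}}$ and $E(x)=\int_0^{\pi/2}\sqrt{1-x^2\sin^2 t}\,dt$. For $r>0$ the singular modulus $k_r\in(0,1)$ is the unique solution $w$ of $K(\sqrt{1-w^2})/K(w)=\sqrt r$, and $a(r)=\frac{\pi}{4K(k_r)^2}-\sqrt r\left(\frac{E(k_r)}{K(k_r)}-1\right)$. $\beta_r\in(0,1)$ is the unique root $w$ of $\frac{{}_2F_1(\frac16,\frac56;1;1-w)}{{}_2F_1(\frac16,\frac56;1;w)}=\sqrt r$. For $s$ with $0<s<1/2$, $K_s(x)=\frac\pi2\,{}_2F_1(\frac12-s,\frac12+s;1;x^2)$ and $E_s(x)=\frac\pi2\,{}_2F_1(-\frac12-s,\frac12+s;1;x^2)$, and the generalized alpha function at the generalized singular value $x_r$ (here $x_r=\sqrt{\beta_r}$ for $s=1/3$, so that $K_{1/3}(\sqrt{1-x_r^2})/K_{1/3}(x_r)=\sqrt r$) is $$a_s(x_r)=\frac{\pi}{4K_s(x_r)^2}\,\frac{\cos(\pi s)}{1+2s}-\sqrt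 r\left(\frac{E_s(x_r)}{K_s(x_r)}-1\right).$$ *)

theory Defs
  imports "HOL-Analysis.Analysis"
begin

text \<open>Gauss hypergeometric function 2F1(a,b;c;x), as its power series (used only for 0 <= x < 1).\<close>
definition hyp2F1 :: "real \<Rightarrow> real \<Rightarrow> real \<Rightarrow> real \<Rightarrow> real" where
  "hyp2F1 a b c x = (\<Sum>n. pochhammer a n * pochhammer b n / (pochhammer c n * fact n) * x ^ n)"

definition ellK :: "real \<Rightarrow> real" where
  "ellK x = integral {0..pi/2} (\<lambda>t. 1 / sqrt (1 - x\<^sup>2 * (sin t)\<^sup>2))"

definition ellE :: "real \<Rightarrow> real" where
  "ellE x = integral {0..pi/2} (\<lambda>t. sqrt (1 - x\<^sup>2 * (sin t)\<^sup>2))"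

definition singular_modulus :: "real \<Rightarrow> real" where
  "singular_modulus r = (THE w. 0 < w \<and> w < 1 \<and> ellK (sqrt (1 - w\<^sup>2)) / ellK w = sqrt r)"

definition elliptic_alpha :: "real \<Rightarrow> real" where
  "elliptic_alpha r = (let k = singular_modulus r in
     pi / (4 * (ellK k)\<^sup>2) - sqrt r * (ellE k / ellK k - 1))"

definition beta_r :: "real \<Rightarrow> real" where
  "beta_r r = (THE w. 0 < w \<and> w < 1 \<and>
      hyp2F1 (1/6) (5/6) 1 (1 - w) / hyp2F1 (1/6) (5/6) 1 w = sqrt r)"

definition genK :: "real \<Rightarrow> real \<Rightarrow> real" where
  "genK s x = pi / 2 * hyp2F1 (1/2 - s) (1/2 + s) 1 (x\<^sup>2)"

definition genE :: "real \<Rightarrow> real \<Rightarrow> real" where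
  "genE s x = pi / 2 * hyp2F1 (-1/2 - s) (1/2 + s) 1 (x\<^sup>2)"

text \<open>Generalized alpha function a_s(x_r), at the generalized singular value x = x_r for r.\<close>
definition gen_alpha :: "real \<Rightarrow> real \<Rightarrow> real \<Rightarrow> real" where
  "gen_alpha s r x = pi / (4 * (genK s x)\<^sup>2) * (cos (pi * s) / (1 + 2 * s))
      - sqrt r * (genE s x / genK s x - 1)"

definition alpha5 :: "real \<Rightarrow> real" where
  "alpha5 r = gen_alpha (1/3) r (sqrt (beta_r r))"

end

theory Submission
  imports Defs
begin

text \<open>
  With $l = k_r^2$, $s = (1-l+l^2)^{1/4}$ and $\beta(l)$ as in \<open>beta_of\<close>, the sextic
  transformation ${}_2F_1(\frac16,\frac56;1;\beta(l)) = s\,{}_2F_1(\frac12,\frac12;1;l)$ holds: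
  the left side divided by $s$ solves the self-adjoint equation $(l(1-l)z')' = z/4$ and is regular
  at $0$, so its Wronskian with the right side divided by $s$ vanishes. Since
  $\beta(1-l) = 1-\beta(l)$, the two modular ratios agree at $\beta(l)$ and $l$; as such a ratio is
  strictly decreasing, $\beta_r = \beta(k_r^2)$. The logarithmic derivative of the transformation,
  rewritten with the contiguous relation for ${}_2F_1(a-1,b;1;x)$, is the asserted identity
  between $E_{1/3}/K_{1/3}$ and $E/K$; the terms in $\pi/K^2$ agree because
  $K_{1/3}^2 = s^2 K^2$.
\<close>

subsection \<open>Gauss hypergeometric series with lower parameter 1\<close>

text \<open>Kept as a formal series so that the differential equation and the contiguous relation
  become coefficient identities. The squared factorial encodes the lower parameter 1, since
  \<open>pochhammer 1 n\<close> is \<open>fact n\<close>.\<close>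

definition hyp_fps :: "real \<Rightarrow> real \<Rightarrow> real fps" where
  "hyp_fps a b = Abs_fps (\<lambda>n. pochhammer a n * pochhammer b n / (fact n)\<^sup>2)"

definition hyp_deriv :: "real \<Rightarrow> real \<Rightarrow> real \<Rightarrow> real" where
  "hyp_deriv a b x = eval_fps (fps_deriv (hyp_fps a b)) x"

lemma hyp2F1_eq_eval_fps: "hyp2F1 a b 1 x = eval_fps (hyp_fps a b) x"
  by (simp add: hyp2F1_def eval_fps_def hyp_fps_def pochhammer_fact[symmetric] power2_eq_square)

lemma hyp2F1_0: "hyp2F1 a b 1 0 = 1"
  by (simp add: hyp2F1_eq_eval_fps eval_fps_at_0 hyp_fps_def)

lemma abs_pochhammer_le_fact:
  fixes a :: real
  assumes "\<bar>a\<bar> \<le> 1"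
  shows "\<bar>pochhammer a n\<bar> \<le> fact n"
proof (induction n)
  case (Suc n)
  have "\<bar>pochhammer a n\<bar> * \<bar>a + real n\<bar> \<le> fact n * real (Suc n)"
    using Suc assms by (intro mult_mono) auto
  then show ?case by (simp add: pochhammer_Suc abs_mult mult.commute)
qed simp

text \<open>Each factor obeys |a + k| <= k + 1, so every coefficient is at most 1 in absolute value
  and a geometric series dominates.\<close>

lemma hyp_fps_conv_radius:
  assumes "\<bar>a\<bar> \<le> 1" "\<bar>b\<bar> \<le> 1"
  shows "fps_conv_radius (hyp_fps a b) \<ge> 1"
  unfolding fps_conv_radius_def
proof (rule conv_radius_geI_ex')
  fix r :: real assume r: "0 < r" "ereal r < 1"
  have "\<bar>fps_nth (hyp_fps a b) n\<bar> \<le> 1" for n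
  proof -
    have "\<bar>pochhammer a n\<bar> * \<bar>pochhammer b n\<bar> \<le> fact n * fact n"
      using assms by (intro mult_mono abs_pochhammer_le_fact) auto
    then show ?thesis by (simp add: hyp_fps_def abs_mult power2_eq_square)
  qed
  then have "norm (fps_nth (hyp_fps a b) n * of_real r ^ n) \<le> r ^ n" for n
    using r mult_right_mono[of "\<bar>fps_nth (hyp_fps a b) n\<bar>" 1 "r ^ n"] by (simp add: abs_mult)
  then show "summable (\<lambda>n. fps_nth (hyp_fps a b) n * of_real r ^ n)"
    using r by (intro summable_comparison_test'[OF summable_geometric[of r]]) auto
qed

section \<open>Differential equation and contiguous relation for the formal series\<close>

lemma hyp_fps_rec:
  "fps_nth (hyp_fps a b) (Suc n) * (real n + 1)\<^sup>2 =
   (a + real n) * (b + real n) * fps_nth (hyp_fps a b) n"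
proof -
  have "fact (Suc n) = (real n + 1) * fact n" by simp
  then show ?thesis
    by (simp add: hyp_fps_def pochhammer_Suc power_mult_distrib del: fact_Suc of_nat_Suc)
qed

text \<open>For a + b = 1 one has (a + n)(b + n) - n(n + 1) = ab, which is exactly what puts the
  coefficient recurrence into self-adjoint form.\<close>

lemma hyp_fps_ode:
  assumes "a + b = 1"
  shows "fps_deriv (fps_X * (1 - fps_X) * fps_deriv (hyp_fps a b)) = fps_const (a * b) * hyp_fps a b"
proof (rule fps_ext)
  fix n
  let ?c = "fps_nth (hyp_fps a b)"
  have b: "b = 1 - a" using assms by simp
  have "fps_X * (1 - fps_X) * fps_deriv (hyp_fps a b)
      = fps_X * fps_deriv (hyp_fps a b) - fps_X * (fps_X * fps_deriv (hyp_fps a b))"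
    by (simp add: algebra_simps)
  moreover have "fps_nth (fps_X * fps_deriv (hyp_fps a b)) (Suc n) = (real n + 1) * ?c (Suc n)"
    by simp
  moreover have "fps_nth (fps_X * (fps_X * fps_deriv (hyp_fps a b))) (Suc n) = real n * ?c n"
    by (cases n) auto
  ultimately have "fps_nth (fps_deriv (fps_X * (1 - fps_X) * fps_deriv (hyp_fps a b))) n
      = (real n + 1) * ((real n + 1) * ?c (Suc n) - real n * ?c n)"
    by (simp only: fps_deriv_nth fps_sub_nth Suc_eq_plus1[symmetric]) (simp add: add.commute)
  also have "\<dots> = ?c (Suc n) * (real n + 1)\<^sup>2 - (real n + 1) * real n * ?c n"
    by (simp add: algebra_simps power2_eq_square)
  also have "\<dots> = a * b * ?c n"
    unfolding hyp_fps_rec b by (simp add: algebra_simps)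
  finally show "fps_nth (fps_deriv (fps_X * (1 - fps_X) * fps_deriv (hyp_fps a b))) n
      = fps_nth (fps_const (a * b) * hyp_fps a b) n" by simp
qed

text \<open>Lowering the first parameter leads from K-type to E-type series, so this relation turns
  quotients E/K into logarithmic derivatives of K.\<close>

lemma hyp_fps_contiguous:
  "fps_const (1 - a) * hyp_fps (a - 1) b =
     fps_X * (1 - fps_X) * fps_deriv (hyp_fps a b)
     + (fps_const (1 - a) - fps_const b * fps_X) * hyp_fps a b"
proof (rule fps_ext)
  fix n
  let ?c = "fps_nth (hyp_fps a b)" and ?d = "fps_nth (hyp_fps (a - 1) b)"
  have eq: "fps_X * (1 - fps_X) * fps_deriv (hyp_fps a b)
     + (fps_const (1 - a) - fps_const b * fps_X) * hyp_fps a b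
     = fps_X * fps_deriv (hyp_fps a b) - fps_X * (fps_X * fps_deriv (hyp_fps a b))
     + fps_const (1 - a) * hyp_fps a b - fps_const b * (fps_X * hyp_fps a b)"
    by (simp add: algebra_simps)
  show "fps_nth (fps_const (1 - a) * hyp_fps (a - 1) b) n =
     fps_nth (fps_X * (1 - fps_X) * fps_deriv (hyp_fps a b)
     + (fps_const (1 - a) - fps_const b * fps_X) * hyp_fps a b) n"
  proof (cases n)
    case 0
    then show ?thesis unfolding eq by (simp add: hyp_fps_def)
  next
    case (Suc m)
    have X: "fps_nth (fps_X * (fps_X * fps_deriv (hyp_fps a b))) n = real m * ?c m"
      unfolding Suc by (cases m) auto
    have f: "fact (Suc m) = (real m + 1) * fact m" by simp
    \<comment> \<open>The rising factorial from a - 1 is the one from a delayed by one factor, which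
      ties coefficient m + 1 of the lowered series to coefficient m of the original.\<close>
    have p: "pochhammer (a - 1) (Suc m) = (a - 1) * pochhammer a m"
      by (simp add: pochhammer_rec)
    have d: "?d (Suc m) * (real m + 1)\<^sup>2 = (a - 1) * (b + real m) * ?c m"
      unfolding hyp_fps_def
      by (simp add: f p pochhammer_Suc[of b] power_mult_distrib del: fact_Suc of_nat_Suc)
    \<comment> \<open>Multiplying by this square makes both recurrences polynomial, so ring
      arithmetic suffices; it is cancelled afterwards.\<close>
    let ?N = "(real m + 1)\<^sup>2"
    have N: "?N \<noteq> 0" by simp
    have "(1 - a) * ?d (Suc m) * ?N = (real m + 2 - a) * (?c (Suc m) * ?N) - (real m + b) * ?c m * ?N"
      unfolding hyp_fps_rec using d by algebra
    then have "((1 - a) * ?d (Suc m)) * ?N = ((real m + 2 - a) * ?c (Suc m) - (real m + b) * ?c m) * ?N"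
      by (simp add: algebra_simps)
    then have "(1 - a) * ?d (Suc m) = (real m + 2 - a) * ?c (Suc m) - (real m + b) * ?c m"
      using N by (simp only: mult_cancel_right) simp
    then show ?thesis
      unfolding eq using X by (simp add: Suc algebra_simps)
  qed
qed

section \<open>Passage from formal series to functions on (-1, 1)\<close>

context
  fixes a b :: real
  assumes ab: "\<bar>a\<bar> \<le> 1" "\<bar>b\<bar> \<le> 1"
begin

lemma norm_less_conv_radius:
  fixes x :: real
  assumes "\<bar>x\<bar> < 1"
  shows "ereal (norm x) < fps_conv_radius (hyp_fps a b)"
    and "ereal (norm x) < fps_conv_radius (fps_deriv (hyp_fps a b))"
    and "ereal (norm x) < fps_conv_radius (fps_X * (1 - fps_X) * fps_deriv (hyp_fps a b))"
proof -
  have x: "ereal (norm x) < 1" using assms by (simp add: one_ereal_def)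
  show 1: "ereal (norm x) < fps_conv_radius (hyp_fps a b)"
    using x hyp_fps_conv_radius[OF ab] by (rule less_le_trans)
  show 2: "ereal (norm x) < fps_conv_radius (fps_deriv (hyp_fps a b))"
    using 1 fps_conv_radius_deriv by (rule less_le_trans)
  have "fps_conv_radius (fps_X * (1 - fps_X) :: real fps) = \<infinity>"
    using fps_conv_radius_mult[of "fps_X :: real fps" "1 - fps_X"]
      fps_conv_radius_diff[of "1 :: real fps" "fps_X"] by simp
  then show "ereal (norm x) < fps_conv_radius (fps_X * (1 - fps_X) * fps_deriv (hyp_fps a b))"
    using 2 fps_conv_radius_mult[of "fps_X * (1 - fps_X)" "fps_deriv (hyp_fps a b)"]
    by (simp add: less_le_trans)
qed

lemma eval_fps_X_one_minus_X_mult: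
  fixes x :: real
  assumes "\<bar>x\<bar> < 1"
  shows "eval_fps (fps_X * (1 - fps_X) * fps_deriv (hyp_fps a b)) x = x * (1 - x) * hyp_deriv a b x"
proof -
  have inf: "fps_conv_radius (1 - fps_X :: real fps) = \<infinity>"
    using fps_conv_radius_diff[of "1 :: real fps" "fps_X"] by simp
  have inf': "fps_conv_radius (fps_X * (1 - fps_X) :: real fps) = \<infinity>"
    using fps_conv_radius_mult[of "fps_X :: real fps" "1 - fps_X"] inf by simp
  show ?thesis
    using norm_less_conv_radius[OF assms]
    by (simp add: eval_fps_mult eval_fps_diff inf inf' hyp_deriv_def)
qed

lemma hyp2F1_has_real_derivative:
  assumes "\<bar>x\<bar> < 1"
  shows "(hyp2F1 a b 1 has_real_derivative hyp_deriv a b x) (at x)"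
  using has_field_derivative_eval_fps[OF norm_less_conv_radius(1)[OF assms], of UNIV]
  by (simp add: hyp2F1_eq_eval_fps[abs_def] hyp_deriv_def)

text \<open>Formulated for the flux x(1 - x)F'(x), so that no second derivative has to be named. The
  explicit flux is matched with the evaluated series only for |x| < 1, hence the transfer along an
  open set.\<close>

lemma hyp2F1_ode:
  assumes "a + b = 1" "\<bar>x\<bar> < 1"
  shows "((\<lambda>x. x * (1 - x) * hyp_deriv a b x) has_real_derivative a * b * hyp2F1 a b 1 x) (at x)"
proof (rule has_field_derivative_transform_within_open)
  show "(eval_fps (fps_X * (1 - fps_X) * fps_deriv (hyp_fps a b)) has_real_derivative
      a * b * hyp2F1 a b 1 x) (at x)"
    using has_field_derivative_eval_fps[OF norm_less_conv_radius(3)[OF assms(2)], of UNIV]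
      norm_less_conv_radius(1)[OF assms(2)]
    by (simp only: hyp_fps_ode[OF assms(1)] hyp2F1_eq_eval_fps) (simp add: eval_fps_mult)
  show "open {-1<..<1::real}" "x \<in> {-1<..<1}" using assms(2) by auto
qed (auto intro!: eval_fps_X_one_minus_X_mult)

end

text \<open>The range 0 <= a <= 1 keeps both a and a - 1 in [-1, 1], so both series converge for |x|
  < 1.\<close>

lemma hyp2F1_contiguous:
  assumes "0 \<le> a" "a \<le> 1" "\<bar>b\<bar> \<le> 1" "\<bar>x\<bar> < 1"
  shows "(1 - a) * hyp2F1 (a - 1) b 1 x
    = x * (1 - x) * hyp_deriv a b x + (1 - a - b * x) * hyp2F1 a b 1 x"
proof -
  have bx: "fps_conv_radius (fps_const b * fps_X) = \<infinity>"
    using fps_conv_radius_mult[of "fps_const b" fps_X] by simp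
  have inf: "fps_conv_radius (fps_const (1 - a) - fps_const b * fps_X) = \<infinity>"
    using fps_conv_radius_diff[of "fps_const (1 - a)" "fps_const b * fps_X"] bx by simp
  have r: "ereal (norm x) < fps_conv_radius (hyp_fps (a - 1) b)"
    "ereal (norm x) < fps_conv_radius (hyp_fps a b)"
    "ereal (norm x) < fps_conv_radius (fps_X * (1 - fps_X) * fps_deriv (hyp_fps a b))"
    using assms by (auto intro!: norm_less_conv_radius simp del: real_norm_def)
  have r': "ereal (norm x) < fps_conv_radius ((fps_const (1 - a) - fps_const b * fps_X) * hyp_fps a b)"
    using r(2) fps_conv_radius_mult[of "fps_const (1 - a) - fps_const b * fps_X" "hyp_fps a b"] inf
    by (simp add: less_le_trans)
  have "(1 - a) * hyp2F1 (a - 1) b 1 x = eval_fps (fps_const (1 - a) * hyp_fps (a - 1) b) x"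
    using r by (simp add: eval_fps_mult hyp2F1_eq_eval_fps)
  also have "\<dots> = eval_fps (fps_X * (1 - fps_X) * fps_deriv (hyp_fps a b)) x
     + eval_fps ((fps_const (1 - a) - fps_const b * fps_X) * hyp_fps a b) x"
    unfolding hyp_fps_contiguous using r r' by (simp add: eval_fps_add)
  also have "eval_fps (fps_X * (1 - fps_X) * fps_deriv (hyp_fps a b)) x
      = x * (1 - x) * hyp_deriv a b x"
    using assms by (intro eval_fps_X_one_minus_X_mult) auto
  also have "eval_fps ((fps_const (1 - a) - fps_const b * fps_X) * hyp_fps a b) x
      = (1 - a - b * x) * hyp2F1 a b 1 x"
    using r by (simp add: eval_fps_mult eval_fps_diff inf bx hyp2F1_eq_eval_fps)
  finally show ?thesis .
qed

subsection \<open>Complete elliptic integrals as hypergeometric series\<close>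

text \<open>Wallis' integral. The reduction formula comes from differentiating cos t sin^(2n+1) t,
  which vanishes at both endpoints.\<close>

lemma has_integral_sin_power_even:
  "((\<lambda>t. sin t ^ (2 * n)) has_integral (pi / 2 * (pochhammer (1/2) n / fact n))) {0..pi/2::real}"
proof (induction n)
  case 0
  have "((\<lambda>t::real. 1::real) has_integral (pi / 2 - 0) *\<^sub>R 1) {0..pi/2}"
    using has_integral_const_real[of "1::real" 0 "pi/2"] by simp
  then show ?case by simp
next
  case (Suc n)
  let ?I = "pi / 2 * (pochhammer (1/2) n / fact n)"
  have D: "((\<lambda>t. cos t * sin t ^ (2*n+1)) has_real_derivative
      (2 * real n + 1) * sin t ^ (2*n) - (2 * real n + 2) * sin t ^ (2 * Suc n)) (at t within A)"
    for t :: real and A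
  proof -
    have c: "cos t ^ 2 = 1 - sin t ^ 2"
      by (simp add: cos_squared_eq)
    have "((\<lambda>t. cos t * sin t ^ (2*n+1)) has_real_derivative
        - sin t * sin t ^ (2*n+1) + cos t * ((2 * real n + 1) * sin t ^ (2*n) * cos t)) (at t within A)"
      by (auto intro!: derivative_eq_intros simp: algebra_simps simp del: power_Suc)
    also have "- sin t * sin t ^ (2*n+1) + cos t * ((2 * real n + 1) * sin t ^ (2*n) * cos t)
      = (2 * real n + 1) * sin t ^ (2*n) - (2 * real n + 2) * sin t ^ (2 * Suc n)"
    proof -
      have "- sin t * sin t ^ (2*n+1) + cos t * ((2 * real n + 1) * sin t ^ (2*n) * cos t)
        = - (sin t ^ 2 * sin t ^ (2*n)) + (2 * real n + 1) * sin t ^ (2*n) * cos t ^ 2"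
        by (simp add: power2_eq_square algebra_simps)
      also have "\<dots> = (2 * real n + 1) * sin t ^ (2*n) - (2 * real n + 2) * (sin t ^ 2 * sin t ^ (2*n))"
        unfolding c by (simp add: algebra_simps)
      finally show ?thesis by (simp add: power2_eq_square)
    qed
    finally show ?thesis .
  qed
  have "((\<lambda>t. (2 * real n + 1) * sin t ^ (2*n) - (2 * real n + 2) * sin t ^ (2 * Suc n)) has_integral
      (cos (pi/2) * sin (pi/2) ^ (2*n+1) - cos 0 * sin 0 ^ (2*n+1))) {0..pi/2}"
    by (rule fundamental_theorem_of_calculus)
       (use D in \<open>auto simp: has_real_derivative_iff_has_vector_derivative[symmetric]\<close>)
  then have 0: "((\<lambda>t. (2 * real n + 1) * sin t ^ (2*n) - (2 * real n + 2) * sin t ^ (2 * Suc n))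
      has_integral 0) {0..pi/2}"
    by simp
  \<comment> \<open>This combination of the induction hypothesis and the vanishing integral isolates
    sin^(2n+2).\<close>
  have "((\<lambda>t. (1 / (2 * real n + 2)) * ((2 * real n + 1) * sin t ^ (2*n) -
      ((2 * real n + 1) * sin t ^ (2*n) - (2 * real n + 2) * sin t ^ (2 * Suc n))))
      has_integral (1 / (2 * real n + 2)) * ((2 * real n + 1) * ?I - 0)) {0..pi/2}"
    by (intro has_integral_mult_right has_integral_diff Suc 0)
  moreover have "(1 / (2 * real n + 2)) * ((2 * real n + 1) * ?I - 0)
      = pi / 2 * (pochhammer (1/2) (Suc n) / fact (Suc n))"
    by (simp add: pochhammer_Suc divide_simps) (simp add: algebra_simps)
  moreover have "(1 / (2 * real n + 2)) * (u - (u - (2 * real n + 2) * v)) = v" for u v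
    by (simp add: field_simps)
  ultimately show ?case by simp
qed

text \<open>The binomial series of the integrand is integrated term by term, with the constant 1/(1
  - y) dominating all partial sums. The cases a = 1/2 and a = -1/2 yield K and E.\<close>

lemma has_integral_binomial_sin:
  assumes "\<bar>a\<bar> \<le> 1" "0 \<le> y" "y < 1"
  shows "((\<lambda>t. (1 - y * (sin t)\<^sup>2) powr (-a)) has_integral pi / 2 * hyp2F1 a (1/2) 1 y) {0..pi/2}"
proof (rule has_integral_dominated_convergence)
  let ?c = "\<lambda>n. pochhammer a n / fact n"
  have c: "\<bar>?c n\<bar> \<le> 1" for n
    using abs_pochhammer_le_fact[OF assms(1), of n] by (simp add: abs_mult)
  show "((\<lambda>t. \<Sum>n<k. ?c n * y ^ n * sin t ^ (2 * n)) has_integral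
      (\<Sum>n<k. ?c n * y ^ n * (pi / 2 * (pochhammer (1/2) n / fact n)))) {0..pi/2}" for k
    by (intro has_integral_sum has_integral_mult_right has_integral_sin_power_even) auto
  show "(\<lambda>t. 1 / (1 - y)) integrable_on {0..pi/2}"
    by (rule integrable_const_ivl)
  show "\<forall>t\<in>{0..pi/2}. norm (\<Sum>n<k. ?c n * y ^ n * sin t ^ (2 * n)) \<le> 1 / (1 - y)" for k
  proof
    fix t :: real
    have "norm (?c n * y ^ n * sin t ^ (2 * n)) \<le> y ^ n" for n
    proof -
      have "\<bar>?c n\<bar> * (y ^ n * \<bar>sin t\<bar> ^ (2 * n)) \<le> 1 * (y ^ n * 1)"
        using assms c by (intro mult_mono power_le_one) auto
      then show ?thesis using assms by (simp add: abs_mult power_abs)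
    qed
    then have "norm (\<Sum>n<k. ?c n * y ^ n * sin t ^ (2 * n)) \<le> (\<Sum>n<k. y ^ n)"
      by (rule sum_norm_le)
    also have "\<dots> \<le> (\<Sum>n. y ^ n)"
      using assms by (intro sum_le_suminf summable_geometric) auto
    also have "\<dots> = 1 / (1 - y)" using assms by (intro suminf_geometric) auto
    finally show "norm (\<Sum>n<k. ?c n * y ^ n * sin t ^ (2 * n)) \<le> 1 / (1 - y)" .
  qed
  show "\<forall>t\<in>{0..pi/2}. (\<lambda>k. \<Sum>n<k. ?c n * y ^ n * sin t ^ (2 * n))
      \<longlonglongrightarrow> (1 - y * (sin t)\<^sup>2) powr (-a)"
  proof
    fix t :: real
    have "y * (sin t)\<^sup>2 \<le> y * 1"
      using assms by (intro mult_left_mono) (auto simp: abs_square_le_1)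
    moreover have "0 \<le> y * (sin t)\<^sup>2" using assms by simp
    ultimately have "\<bar>- (y * (sin t)\<^sup>2)\<bar> < 1" using assms by simp
    from gen_binomial_real[OF this, of "-a"]
    have "(\<lambda>n. ((-a) gchoose n) * (- (y * (sin t)\<^sup>2)) ^ n) sums (1 - y * (sin t)\<^sup>2) powr (-a)"
      by simp
    \<comment> \<open>The sign (-1)^n from the binomial coefficient at -a cancels the one from the
      negative argument.\<close>
    moreover have "((-a) gchoose n) * (- (y * (sin t)\<^sup>2)) ^ n = ?c n * y ^ n * sin t ^ (2 * n)" for n
    proof -
      have "(-1) ^ n * ((-1) ^ n * x) = x" for x :: real
        by (simp add: mult.assoc[symmetric] power_mult_distrib[symmetric])
      then show ?thesis
        by (simp add: gbinomial_pochhammer power_minus[of "y * (sin t)\<^sup>2"] power_mult power_mult_distrib)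
    qed
    ultimately show "(\<lambda>k. \<Sum>n<k. ?c n * y ^ n * sin t ^ (2 * n))
      \<longlonglongrightarrow> (1 - y * (sin t)\<^sup>2) powr (-a)"
      by (simp add: sums_def)
  qed
  have "(\<lambda>n. fps_nth (hyp_fps a (1/2)) n * y ^ n) sums eval_fps (hyp_fps a (1/2)) y"
    using norm_less_conv_radius(1)[of a "1/2" y] assms by (intro sums_eval_fps) auto
  then have "(\<lambda>n. pi / 2 * (fps_nth (hyp_fps a (1/2)) n * y ^ n)) sums (pi / 2 * hyp2F1 a (1/2) 1 y)"
    unfolding hyp2F1_eq_eval_fps by (rule sums_mult)
  then show "(\<lambda>k. \<Sum>n<k. ?c n * y ^ n * (pi / 2 * (pochhammer (1/2) n / fact n)))
      \<longlonglongrightarrow> pi / 2 * hyp2F1 a (1/2) 1 y"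
    by (simp add: sums_def hyp_fps_def power2_eq_square mult_ac)
qed

lemma ellK_eq_hyp2F1:
  assumes "0 \<le> x" "x < 1"
  shows "ellK x = pi / 2 * hyp2F1 (1/2) (1/2) 1 (x\<^sup>2)"
proof -
  have x: "x\<^sup>2 < 1" using assms by (simp add: power_less_one_iff abs_square_less_1)
  have "((\<lambda>t. 1 / sqrt (1 - x\<^sup>2 * (sin t)\<^sup>2)) has_integral pi / 2 * hyp2F1 (1/2) (1/2) 1 (x\<^sup>2)) {0..pi/2}"
  proof (rule has_integral_eq)
    show "((\<lambda>t. (1 - x\<^sup>2 * (sin t)\<^sup>2) powr (-(1/2))) has_integral
        pi / 2 * hyp2F1 (1/2) (1/2) 1 (x\<^sup>2)) {0..pi/2}"
      using x by (intro has_integral_binomial_sin) auto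
    fix t :: real
    \<comment> \<open>Gives a nonnegative base, needed to read \<open>powr\<close> with exponent 1/2
      as a square root.\<close>
    have "x\<^sup>2 * (sin t)\<^sup>2 \<le> 1 * 1"
      using x abs_square_le_1[of "sin t"] by (intro mult_mono) auto
    then show "(1 - x\<^sup>2 * (sin t)\<^sup>2) powr (-(1/2)) = 1 / sqrt (1 - x\<^sup>2 * (sin t)\<^sup>2)"
      by (simp add: powr_minus_divide powr_half_sqrt)
  qed
  then show ?thesis unfolding ellK_def by (rule integral_unique)
qed

lemma ellE_eq_hyp2F1:
  assumes "0 \<le> x" "x < 1"
  shows "ellE x = pi / 2 * hyp2F1 (-1/2) (1/2) 1 (x\<^sup>2)"
proof -
  have x: "x\<^sup>2 < 1" using assms by (simp add: power_less_one_iff abs_square_less_1)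
  have "((\<lambda>t. sqrt (1 - x\<^sup>2 * (sin t)\<^sup>2)) has_integral pi / 2 * hyp2F1 (-1/2) (1/2) 1 (x\<^sup>2)) {0..pi/2}"
  proof (rule has_integral_eq)
    show "((\<lambda>t. (1 - x\<^sup>2 * (sin t)\<^sup>2) powr (-(-1/2))) has_integral
        pi / 2 * hyp2F1 (-1/2) (1/2) 1 (x\<^sup>2)) {0..pi/2}"
      using x by (intro has_integral_binomial_sin) auto
    fix t :: real
    have "x\<^sup>2 * (sin t)\<^sup>2 \<le> 1 * 1"
      using x abs_square_le_1[of "sin t"] by (intro mult_mono) auto
    then show "(1 - x\<^sup>2 * (sin t)\<^sup>2) powr (-(-1/2)) = sqrt (1 - x\<^sup>2 * (sin t)\<^sup>2)"
      by (simp add: powr_half_sqrt)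
  qed
  then show ?thesis unfolding ellE_def by (rule integral_unique)
qed

subsection \<open>Growth of the hypergeometric function and its modular ratio\<close>

text \<open>All coefficients are nonnegative and the constant one is 1. The bound also keeps the
  denominators of the modular ratios away from zero.\<close>

lemma hyp2F1_ge_1:
  assumes "0 < a" "0 < b" "a \<le> 1" "b \<le> 1" "0 \<le> x" "x < 1"
  shows "1 \<le> hyp2F1 a b 1 x"
proof -
  have F: "(\<lambda>n. fps_nth (hyp_fps a b) n * x ^ n) sums hyp2F1 a b 1 x"
    unfolding hyp2F1_eq_eval_fps using assms
    by (intro sums_eval_fps norm_less_conv_radius) auto
  have one: "(\<lambda>n. if n = 0 then 1 else 0) sums (1::real)"
    by (rule sums_single)
  have le: "(if n = 0 then 1 else 0) \<le> fps_nth (hyp_fps a b) n * x ^ n" for n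
    using assms by (simp add: hyp_fps_def pochhammer_nonneg)
  show ?thesis by (rule sums_le[OF le one F])
qed

text \<open>Integrates the self-adjoint equation, using that the series is at least 1.\<close>
lemma hyp_deriv_ge:
  assumes "0 < a" "0 < b" "a + b = 1" "0 < x" "x < 1"
  shows "a * b / (1 - x) \<le> hyp_deriv a b x"
proof -
  let ?G = "\<lambda>x. x * (1 - x) * hyp_deriv a b x - a * b * x"
  have "?G 0 \<le> ?G x"
  proof (rule DERIV_nonneg_imp_nondecreasing[where f="?G"])
    fix y assume y: "0 \<le> y" "y \<le> x"
    have "(?G has_real_derivative a * b * hyp2F1 a b 1 y - a * b) (at y)"
      using assms y by (intro DERIV_diff hyp2F1_ode) (auto intro!: derivative_eq_intros)
    moreover have "a * b * 1 \<le> a * b * hyp2F1 a b 1 y"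
      using hyp2F1_ge_1[of a b y] assms y by (intro mult_left_mono) auto
    ultimately show "\<exists>d. (?G has_real_derivative d) (at y) \<and> 0 \<le> d" by auto
  qed (use assms in auto)
  then have "x * (a * b) \<le> x * ((1 - x) * hyp_deriv a b x)" by (simp add: mult_ac)
  then have "a * b \<le> (1 - x) * hyp_deriv a b x" using assms by simp
  then show ?thesis using assms by (simp add: divide_le_eq mult.commute)
qed

lemma hyp2F1_strict_mono:
  assumes "0 < a" "0 < b" "a + b = 1" "0 \<le> x" "x < y" "y < 1"
  shows "hyp2F1 a b 1 x < hyp2F1 a b 1 y"
\<comment> \<open>The derivative bound \<open>hyp_deriv_ge\<close> excludes the point 0, so
  positivity is used on the open interval only and continuity supplies the endpoints.\<close>
proof (rule DERIV_pos_imp_increasing_open[where f="hyp2F1 a b 1"])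
  fix z assume z: "x < z" "z < y"
  have "0 < a * b / (1 - z)" using assms z by simp
  also have "\<dots> \<le> hyp_deriv a b z" using assms z by (intro hyp_deriv_ge) auto
  finally have "0 < hyp_deriv a b z" .
  then show "\<exists>d. (hyp2F1 a b 1 has_real_derivative d) (at z) \<and> 0 < d"
    using hyp2F1_has_real_derivative[of a b z] assms z by auto
next
  show "continuous_on {x..y} (hyp2F1 a b 1)"
    using assms
    by (intro DERIV_continuous_on[where D="hyp_deriv a b"]
        DERIV_subset[OF hyp2F1_has_real_derivative]) auto
qed (use assms in auto)

text \<open>Integrates \<open>hyp_deriv_ge\<close> once more; the logarithm forces the series to
  blow up at 1.\<close>

lemma hyp2F1_ge_ln:
  assumes "0 < a" "0 < b" "a + b = 1" "0 \<le> x" "x < 1"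
  shows "1 - a * b * ln (1 - x) \<le> hyp2F1 a b 1 x"
proof -
  let ?G = "\<lambda>x. hyp2F1 a b 1 x + a * b * ln (1 - x)"
  have D: "(?G has_real_derivative hyp_deriv a b y - a * b / (1 - y)) (at y)"
    if "0 \<le> y" "y \<le> x" for y
    using that assms hyp2F1_has_real_derivative[of a b y]
    by (auto intro!: derivative_eq_intros simp: field_simps)
  have "?G 0 \<le> ?G x"
  proof (rule DERIV_nonneg_imp_increasing_open[where f="?G"])
    fix y assume y: "0 < y" "y < x"
    then have "0 \<le> hyp_deriv a b y - a * b / (1 - y)"
      using hyp_deriv_ge[of a b y] assms by simp
    then show "\<exists>d. (?G has_real_derivative d) (at y) \<and> 0 \<le> d"
      using D[of y] y by auto
  next
    show "continuous_on {0..x} ?G"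
      by (rule DERIV_continuous_on[where D="\<lambda>y. hyp_deriv a b y - a * b / (1 - y)"],
          rule DERIV_subset[OF D]) auto
  qed (use assms in auto)
  then show ?thesis by (simp add: hyp2F1_0)
qed

section \<open>The modular ratio as a bijection from (0, 1) onto the positive reals\<close>

lemma hyp2F1_ratio_strict_antimono:
  assumes "0 < a" "0 < b" "a + b = 1" "0 < x" "x < y" "y < 1"
  shows "hyp2F1 a b 1 (1 - y) / hyp2F1 a b 1 y < hyp2F1 a b 1 (1 - x) / hyp2F1 a b 1 x"
proof -
  have "1 \<le> hyp2F1 a b 1 x" "1 \<le> hyp2F1 a b 1 (1 - y)"
    using assms by (auto intro!: hyp2F1_ge_1)
  then show ?thesis
    using assms hyp2F1_strict_mono[of a b x y] hyp2F1_strict_mono[of a b "1 - y" "1 - x"]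
    by (intro frac_less) auto
qed

lemma hyp2F1_ratio_unique:
  assumes "0 < a" "0 < b" "a + b = 1" "0 < x" "x < 1" "0 < y" "y < 1"
    and "hyp2F1 a b 1 (1 - x) / hyp2F1 a b 1 x = hyp2F1 a b 1 (1 - y) / hyp2F1 a b 1 y"
  shows "x = y"
  using hyp2F1_ratio_strict_antimono[of a b x y] hyp2F1_ratio_strict_antimono[of a b y x] assms
  by (cases x y rule: linorder_cases) auto

lemma hyp2F1_arbitrarily_large:
  assumes "0 < a" "0 < b" "a + b = 1"
  obtains w where "1/2 \<le> w" "w < 1" "M < hyp2F1 a b 1 w"
proof
  \<comment> \<open>Chosen so that -ab ln t = |M| + ab, which makes the logarithmic lower bound
    exceed M as soon as 1 - w <= t.\<close>
  define t where "t = exp (- (\<bar>M\<bar> / (a * b) + 1))"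
  let ?w = "max (1/2) (1 - t)"
  have w0: "0 \<le> ?w" by simp
  have t: "0 < t" by (simp add: t_def)
  show w: "1/2 \<le> ?w" "?w < 1" using t by auto
  have "ln (1 - ?w) \<le> ln t" using w by (subst ln_le_cancel_iff) (use t in auto)
  also have "ln t = - (\<bar>M\<bar> / (a * b) + 1)" by (simp add: t_def)
  finally have "\<bar>M\<bar> / (a * b) + 1 \<le> - ln (1 - ?w)" by simp
  then have "a * b * (\<bar>M\<bar> / (a * b) + 1) \<le> a * b * (- ln (1 - ?w))"
    using assms by (intro mult_left_mono) auto
  moreover have "a * b * (\<bar>M\<bar> / (a * b) + 1) = \<bar>M\<bar> + a * b"
    using assms by (simp add: algebra_simps)
  moreover have "0 < a * b" using assms by simp
  ultimately show "M < hyp2F1 a b 1 ?w"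
    using hyp2F1_ge_ln[OF assms w0 w(2)] by (simp only: mult_minus_right)
qed

text \<open>Intermediate value theorem for F(1 - w) - c F(w): the blow-up at 1 makes this positive
  near 0 and negative near 1.\<close>

lemma hyp2F1_ratio_surj:
  assumes "0 < a" "0 < b" "a + b = 1" "0 < c"
  obtains w where "0 < w" "w < 1" "hyp2F1 a b 1 (1 - w) / hyp2F1 a b 1 w = c"
proof -
  let ?F = "hyp2F1 a b 1"
  let ?g = "\<lambda>w. ?F (1 - w) - c * ?F w"
  have mono: "?F w \<le> ?F (1/2)" if "0 < w" "w \<le> 1/2" for w
  proof (cases "w < 1/2")
    case True
    then show ?thesis using hyp2F1_strict_mono[of a b w "1/2"] assms that by simp
  next
    case False
    with that have "w = 1/2" by simp
    then show ?thesis by (simp only: order.refl)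
  qed
  \<comment> \<open>The point 1 - u will serve as left end and v as right end of the bracket; both
    being at least 1/2 puts them in the correct order.\<close>
  obtain u where u: "1/2 \<le> u" "u < 1" "c * ?F (1/2) < ?F u"
    using hyp2F1_arbitrarily_large assms by metis
  obtain v where v: "1/2 \<le> v" "v < 1" "?F (1/2) / c < ?F v"
    using hyp2F1_arbitrarily_large assms by metis
  have "\<exists>w. 1 - u \<le> w \<and> w \<le> v \<and> ?g w = 0"
  proof (rule IVT2)
    have "?F (1 - v) \<le> ?F (1/2)" using v by (intro mono) auto
    also have "?F (1/2) < c * ?F v" using v(3) assms by (simp add: divide_less_eq mult.commute)
    finally show "?g v \<le> 0" by simp
    have "c * ?F (1 - u) \<le> c * ?F (1/2)" using u assms by (intro mult_left_mono mono) auto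
    with u(3) show "0 \<le> ?g (1 - u)" by simp
    show "1 - u \<le> v" using u v by simp
    have c: "isCont ?F x" if "0 < x" "x < 1" for x
      using hyp2F1_has_real_derivative[of a b x] assms that by (intro DERIV_isCont) auto
    have "isCont ?g x" if "1 - u \<le> x" "x \<le> v" for x
      using that u v
      by (intro continuous_diff continuous_mult continuous_const isCont_o2[OF _ c] c) auto
    then show "\<forall>x. 1 - u \<le> x \<and> x \<le> v \<longrightarrow> isCont ?g x" by blast
  qed
  then obtain w where w: "1 - u \<le> w" "w \<le> v" "?g w = 0" by blast
  then have w01: "0 < w" "w < 1" using u v by auto
  moreover have "?F w \<noteq> 0" using hyp2F1_ge_1[of a b w] assms w01 by auto
  ultimately show ?thesis using that w(3) by (simp add: divide_eq_eq)
qed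

subsection \<open>The sextic transformation\<close>

definition quad :: "real \<Rightarrow> real" where
  "quad l = 1 - l + l\<^sup>2"

definition root_quad :: "real \<Rightarrow> real" where
  "root_quad l = sqrt (sqrt (quad l))"

text \<open>With j the modular invariant at l, this is the root of 4 beta (1 - beta) = 1728/j that
  vanishes at l = 0. The sixth power of \<open>root_quad\<close> stands for (1 - l +
  l^2)^(3/2).\<close>

definition beta_of :: "real \<Rightarrow> real" where
  "beta_of l = (1 - (1 + l) * (1 - l/2) * (1 - 2*l) / root_quad l ^ 6) / 2"

lemma quad_pos: "0 < quad l"
proof -
  have "quad l = (l - 1/2)\<^sup>2 + 3/4" by (simp add: quad_def power2_eq_square algebra_simps)
  then show ?thesis by (simp add: add_nonneg_pos)
qed

lemma root_quad_pos: "0 < root_quad l"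
  by (simp add: root_quad_def quad_pos)

lemma root_quad_sq: "root_quad l ^ 2 = sqrt (quad l)"
  using quad_pos[of l] by (simp add: root_quad_def)

lemma root_quad_pow4: "root_quad l ^ 4 = quad l"
proof -
  have "root_quad l ^ 4 = (root_quad l ^ 2) ^ 2" by simp
  then show ?thesis unfolding root_quad_sq using quad_pos[of l] by simp
qed

lemma root_quad_one_minus: "root_quad (1 - l) = root_quad l"
  by (simp add: root_quad_def quad_def power2_eq_square algebra_simps)

lemma beta_of_one_minus: "beta_of (1 - l) = 1 - beta_of l"
proof -
  have "(1 + (1 - l)) * (1 - (1 - l)/2) * (1 - 2*(1 - l)) = - ((1 + l) * (1 - l/2) * (1 - 2*l))"
    by (simp add: field_simps)
  then show ?thesis
    unfolding beta_of_def root_quad_one_minus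
    by (simp only: minus_divide_left[symmetric]) (simp add: diff_divide_distrib)
qed

lemma root_quad_has_real_derivative:
  "(root_quad has_real_derivative (2*l - 1) / (4 * root_quad l ^ 3)) (at l)"
proof -
  have q: "(quad has_real_derivative 2 * l - 1) (at l)"
    unfolding quad_def[abs_def] by (auto intro!: derivative_eq_intros)
  have "(root_quad has_real_derivative
      inverse (sqrt (sqrt (quad l))) / 2 * (inverse (sqrt (quad l)) / 2 * (2 * l - 1))) (at l)"
    unfolding root_quad_def[abs_def]
    by (intro DERIV_chain2[OF DERIV_real_sqrt] DERIV_chain2[OF DERIV_real_sqrt q])
       (simp_all add: quad_pos)
  also have "inverse (sqrt (sqrt (quad l))) / 2 * (inverse (sqrt (quad l)) / 2 * (2 * l - 1))
      = (2*l - 1) / (4 * root_quad l ^ 3)"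
    unfolding root_quad_sq[symmetric] root_quad_def[symmetric]
    using root_quad_pos[of l] by (simp add: field_simps power2_eq_square power3_eq_cube)
  finally show ?thesis .
qed

text \<open>Rests on (1 - l + l^2)^3 - ((1 + l)(1 - l/2)(1 - 2l))^2 = 27 l^2 (1 - l)^2 / 4, the
  Legendre form of E4^3 - E6^2 = 1728 Delta.\<close>

lemma beta_of_mult: "beta_of l * (1 - beta_of l) = 27 * (l * (1 - l))\<^sup>2 / (16 * root_quad l ^ 12)"
proof -
  define s where "s = root_quad l"
  have s: "s \<noteq> 0" using root_quad_pos[of l] by (simp add: s_def)
  have s12: "s ^ 12 = (1 - l + l\<^sup>2) ^ 3"
    unfolding root_quad_pow4[of l, unfolded quad_def, symmetric] s_def by (simp flip: power_mult)
  let ?N = "(1 + l) * (1 - l/2) * (1 - 2*l)"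
  have "beta_of l * (1 - beta_of l) = (1 - (?N / s ^ 6)\<^sup>2) / 4"
  proof -
    have "(1 - c) / 2 * (1 - (1 - c) / 2) = (1 - c\<^sup>2) / 4" for c :: real
      by (simp add: power2_eq_square field_simps)
    then show ?thesis unfolding beta_of_def s_def .
  qed
  also have "\<dots> = (s ^ 12 - ?N\<^sup>2) / (4 * s ^ 12)"
    using s by (simp add: power_divide field_simps flip: power_mult)
  also have "s ^ 12 - ?N\<^sup>2 = 27 * (l * (1 - l))\<^sup>2 / 4"
    unfolding s12 by (simp add: field_simps) algebra
  finally show ?thesis by (simp add: s_def)
qed

text \<open>The product beta (1 - beta) is positive, and its two factors cannot both be
  negative.\<close>

lemma beta_of_bounds:
  assumes "0 < l" "l < 1"
  shows "0 < beta_of l" "beta_of l < 1"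
proof -
  have "0 < beta_of l * (1 - beta_of l)"
    unfolding beta_of_mult using assms root_quad_pos[of l] by simp
  then show "0 < beta_of l" "beta_of l < 1"
    by (auto simp: zero_less_mult_iff)
qed

lemma beta_of_0: "beta_of 0 = 0"
  by (simp add: beta_of_def root_quad_def quad_def)

lemma beta_of_has_real_derivative:
  "(beta_of has_real_derivative 27 * l * (1 - l) / (8 * root_quad l ^ 10)) (at l)"
proof -
  define s where "s = root_quad l"
  have s: "s \<noteq> 0" using root_quad_pos[of l] by (simp add: s_def)
  have p: "s ^ 4 = 1 - l + l\<^sup>2" using root_quad_pow4[of l] by (simp add: s_def quad_def)
  let ?N = "\<lambda>l::real. (1 + l) * (1 - l/2) * (1 - 2*l)"
  let ?N' = "(1 - l/2) * (1 - 2*l) - (1 + l) * (1 - 2*l) / 2 - 2 * (1 + l) * (1 - l/2)"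
  have N: "(?N has_real_derivative ?N') (at l)"
    by (auto intro!: derivative_eq_intros simp: field_simps)
  have S: "((\<lambda>l. root_quad l ^ 6) has_real_derivative 6 * s ^ 5 * ((2*l - 1) / (4 * s ^ 3))) (at l)"
    using DERIV_power[OF root_quad_has_real_derivative[of l], of 6] by (simp add: s_def mult_ac)
  have "(beta_of has_real_derivative
      - ((?N' * s ^ 6 - ?N l * (6 * s ^ 5 * ((2*l - 1) / (4 * s ^ 3)))) / (s ^ 6 * s ^ 6)) / 2) (at l)"
  proof -
    have "((\<lambda>l. (1 - ?N l / root_quad l ^ 6) / 2) has_real_derivative
      (0 - (?N' * s ^ 6 - ?N l * (6 * s ^ 5 * ((2*l - 1) / (4 * s ^ 3)))) / (s ^ 6 * s ^ 6)) / 2) (at l)"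
      unfolding s_def
      by (intro DERIV_cdivide DERIV_diff DERIV_const DERIV_divide N S[unfolded s_def])
         (use s in \<open>simp add: s_def\<close>)
    then show ?thesis by (simp add: beta_of_def[abs_def])
  qed
  also have "6 * s ^ 5 * ((2*l - 1) / (4 * s ^ 3)) = 3/2 * s ^ 2 * (2*l - 1)"
    using s by (simp add: field_simps eval_nat_numeral)
  also have "- ((?N' * s ^ 6 - ?N l * (3/2 * s ^ 2 * (2*l - 1))) / (s ^ 6 * s ^ 6)) / 2
    = - (s ^ 2 * (?N' * s ^ 4 - ?N l * (3/2 * (2*l - 1)))) / (2 * (s ^ 6 * s ^ 6))"
  proof -
    have "s ^ 6 = s ^ 2 * s ^ 4" by (simp flip: power_add)
    then have "u * s ^ 6 - v * (3/2 * s ^ 2 * w) = s ^ 2 * (u * s ^ 4 - v * (3/2 * w))" for u v w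
      by (simp add: algebra_simps)
    then show ?thesis by simp
  qed
  \<comment> \<open>Once s^2 is factored out, s enters only through s^4, a polynomial in l, and the
    numerator collapses.\<close>
  also have "?N' * s ^ 4 - ?N l * (3/2 * (2*l - 1)) = - 27/4 * l * (1 - l)"
    unfolding p by (simp add: field_simps) algebra
  also have "- (s ^ 2 * (- 27/4 * l * (1 - l))) / (2 * (s ^ 6 * s ^ 6)) = 27 * l * (1 - l) / (8 * s ^ 10)"
  proof -
    have e: "s ^ 6 * s ^ 6 = s ^ 2 * s ^ 10" by (simp flip: power_add)
    have *: "- (u * (- 27/4 * l * (1 - l))) / (2 * (u * v)) = 27 * l * (1 - l) / (8 * v)"
      if "u \<noteq> 0" for u v
      using that by simp
    show ?thesis unfolding e using s by (intro *) simp
  qed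
  finally show ?thesis by (simp add: s_def)
qed

text \<open>Converts the operator x(1 - x) d/dx at x = beta(l) into the one at x = l, the factor
  being 2 s^2. It removes powers of l from denominators, so it also serves at l = 0.\<close>

lemma beta_of_deriv_mult:
  "l * (1 - l) * (27 * l * (1 - l) / (8 * root_quad l ^ 10))
    = 2 * root_quad l ^ 2 * (beta_of l * (1 - beta_of l))"
  unfolding beta_of_mult using root_quad_pos[of l]
  by (simp add: field_simps power2_eq_square eval_nat_numeral)

subsection \<open>Equality of the two solutions\<close>

definition pulled_back :: "real \<Rightarrow> real" where
  "pulled_back l = hyp2F1 (1/6) (5/6) 1 (beta_of l) / root_quad l"

text \<open>This is $l(1-l)$ times the derivative of \<open>pulled_back\<close>, in a form without division by $l$.\<close>
definition pulled_back_flux :: "real \<Rightarrow> real" where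
  "pulled_back_flux l = l * (1 - l) * (1 - 2*l) / (4 * root_quad l ^ 5) * hyp2F1 (1/6) (5/6) 1 (beta_of l)
     + 2 * root_quad l * (beta_of l * (1 - beta_of l) * hyp_deriv (1/6) (5/6) (beta_of l))"

lemma beta_of_abs_less_1:
  assumes "0 \<le> l" "l < 1"
  shows "\<bar>beta_of l\<bar> < 1"
proof (cases "l = 0")
  case True
  then show ?thesis by (simp add: beta_of_0)
next
  case False
  then show ?thesis using beta_of_bounds[of l] assms by simp
qed

lemma hyp2F1_beta_of_has_real_derivative:
  assumes "0 \<le> l" "l < 1"
  shows "((\<lambda>l. hyp2F1 (1/6) (5/6) 1 (beta_of l)) has_real_derivative
    hyp_deriv (1/6) (5/6) (beta_of l) * (27 * l * (1 - l) / (8 * root_quad l ^ 10))) (at l)"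
  by (rule DERIV_chain2[OF hyp2F1_has_real_derivative beta_of_has_real_derivative])
     (use beta_of_abs_less_1[OF assms] in simp_all)

text \<open>The derivative is obtained as a witness tied to the flux by multiplication, since
  dividing the flux by l(1 - l) would fail at l = 0.\<close>

lemma pulled_back_has_real_derivative:
  assumes l: "0 \<le> l" "l < 1"
  obtains D where "(pulled_back has_real_derivative D) (at l)"
    and "l * (1 - l) * D = pulled_back_flux l"
proof -
  define s where "s = root_quad l"
  have s: "s \<noteq> 0" using root_quad_pos[of l] by (simp add: s_def)
  define F where "F = hyp2F1 (1/6) (5/6) 1 (beta_of l)"
  define F' where "F' = hyp_deriv (1/6) (5/6) (beta_of l)"
  define b' where "b' = 27 * l * (1 - l) / (8 * s ^ 10)"
  have b': "l * (1 - l) * b' = 2 * s ^ 2 * (beta_of l * (1 - beta_of l))"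
    using beta_of_deriv_mult[of l] by (simp add: b'_def s_def)
  let ?D = "(F' * b' * s - F * ((2*l - 1) / (4 * s ^ 3))) / (s * s)"
  show ?thesis
  proof
    show "(pulled_back has_real_derivative ?D) (at l)"
      unfolding pulled_back_def[abs_def] F_def F'_def b'_def s_def using s
      by (intro DERIV_divide hyp2F1_beta_of_has_real_derivative root_quad_has_real_derivative l)
         (simp add: s_def)
    have "l * (1 - l) * ?D = (F' * (l * (1 - l) * b') * s - l * (1 - l) * F * ((2*l - 1) / (4 * s ^ 3))) / (s * s)"
      by (simp add: algebra_simps)
    also have "\<dots> = l * (1 - l) * (1 - 2*l) / (4 * s ^ 5) * F
        + 2 * s * (beta_of l * (1 - beta_of l) * F')"
      unfolding b' using s by (simp add: field_simps eval_nat_numeral)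
    finally show "l * (1 - l) * ?D = pulled_back_flux l"
      by (simp add: pulled_back_flux_def F_def F'_def s_def)
  qed
qed

text \<open>In the derivative of the flux the terms with F' cancel, thanks to the factor 1/s in
  \<open>pulled_back\<close>, and the coefficient of F simplifies to 1/(4s). The result is the
  equation satisfied by 2F1(1/2, 1/2; 1; l).\<close>

lemma pulled_back_flux_has_real_derivative:
  assumes l: "0 \<le> l" "l < 1"
  shows "(pulled_back_flux has_real_derivative pulled_back l / 4) (at l)"
proof -
  define s where "s = root_quad l"
  have s: "s \<noteq> 0" using root_quad_pos[of l] by (simp add: s_def)
  have p: "s ^ 4 = 1 - l + l\<^sup>2" using root_quad_pow4[of l] by (simp add: s_def quad_def)
  define F where "F = hyp2F1 (1/6) (5/6) 1 (beta_of l)"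
  define F' where "F' = hyp_deriv (1/6) (5/6) (beta_of l)"
  define H where "H = beta_of l * (1 - beta_of l) * F'"
  define b' where "b' = 27 * l * (1 - l) / (8 * s ^ 10)"
  have b': "l * (1 - l) * b' = 2 * s ^ 2 * (beta_of l * (1 - beta_of l))"
    using beta_of_deriv_mult[of l] by (simp add: b'_def s_def)
  let ?q = "\<lambda>l::real. l * (1 - l) * (1 - 2*l)"
  let ?A = "\<lambda>l. ?q l / (4 * root_quad l ^ 5)"
  define A' where "A' = ((1 - 6*l + 6*l\<^sup>2) * (4 * s ^ 5) - ?q l * (4 * (5 * s ^ 4 * ((2*l - 1) / (4 * s ^ 3)))))
      / ((4 * s ^ 5) * (4 * s ^ 5))"
  have q: "(?q has_real_derivative (1 - 6*l + 6*l\<^sup>2)) (at l)"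
    by (auto intro!: derivative_eq_intros simp: algebra_simps power2_eq_square)
  have S: "((\<lambda>l. 4 * root_quad l ^ 5) has_real_derivative 4 * (5 * s ^ 4 * ((2*l - 1) / (4 * s ^ 3)))) (at l)"
    using DERIV_power[OF root_quad_has_real_derivative[of l], of 5]
    by (intro DERIV_cmult) (simp add: s_def mult_ac)
  have A: "(?A has_real_derivative A') (at l)"
    unfolding A'_def s_def
    by (intro DERIV_divide q S[unfolded s_def]) (use s in \<open>simp add: s_def\<close>)
  have H': "((\<lambda>l. beta_of l * (1 - beta_of l) * hyp_deriv (1/6) (5/6) (beta_of l)) has_real_derivative
      1/6 * (5/6) * F * b') (at l)"
    unfolding F_def b'_def s_def
    by (rule DERIV_chain2[OF hyp2F1_ode beta_of_has_real_derivative])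
       (use beta_of_abs_less_1[OF l] in auto)
  have D: "(pulled_back_flux has_real_derivative
      (A' * F + (F' * b') * ?A l) +
      ((2 * ((2*l - 1) / (4 * s ^ 3))) * H + (1/6 * (5/6) * F * b') * (2 * s))) (at l)"
    unfolding pulled_back_flux_def[abs_def]
    unfolding F_def F'_def H_def b'_def s_def
    by (intro DERIV_add DERIV_mult' DERIV_mult DERIV_cmult A hyp2F1_beta_of_has_real_derivative l
        root_quad_has_real_derivative H'[unfolded F_def b'_def s_def])
  \<comment> \<open>The factor l(1 - l) inside \<open>?A\<close> absorbs b', so this term becomes a
    multiple of H, ready to cancel.\<close>
  have Ab: "(F' * b') * ?A l = (1 - 2*l) / (2 * s ^ 3) * H"
  proof -
    have "(F' * b') * ?A l = (l * (1 - l) * b') * (F' * (1 - 2*l) / (4 * s ^ 5))"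
      by (simp add: s_def)
    also have "\<dots> = (1 - 2*l) / (2 * s ^ 3) * H"
      unfolding b' H_def using s by (simp add: field_simps eval_nat_numeral)
    finally show ?thesis .
  qed
  have "A' + 1/6 * (5/6) * b' * (2 * s) = 1 / (4 * s)"
  proof -
    have 1: "A' = (4 * (1 - 6*l + 6*l\<^sup>2) * s ^ 4 - 5 * ?q l * (2*l - 1)) / (16 * s ^ 9)"
      unfolding A'_def using s by (simp add: field_simps eval_nat_numeral)
    have 2: "1/6 * (5/6) * b' * (2 * s) = 15 * l * (1 - l) / (16 * s ^ 9)"
      unfolding b'_def using s by (simp add: field_simps eval_nat_numeral)
    have 3: "1 / (4 * s) = 4 * (s ^ 4 * s ^ 4) / (16 * s ^ 9)"
      using s by (simp add: field_simps eval_nat_numeral)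
    \<comment> \<open>Over the common denominator 16 s^9, the coefficient of F is settled by this
      identity in l alone.\<close>
    have 4: "4 * (1 - 6*l + 6*l\<^sup>2) * s ^ 4 - 5 * ?q l * (2*l - 1) + 15 * l * (1 - l) = 4 * (s ^ 4 * s ^ 4)"
      unfolding p by algebra
    show ?thesis unfolding 1 2 3 4[symmetric] by (simp add: add_divide_distrib)
  qed
  moreover have "A' * F + 1/6 * (5/6) * F * b' * (2 * s) = (A' + 1/6 * (5/6) * b' * (2 * s)) * F"
    by (simp add: algebra_simps)
  ultimately have sum: "A' * F + 1/6 * (5/6) * F * b' * (2 * s) = pulled_back l / 4"
    by (simp add: pulled_back_def F_def[symmetric] s_def[symmetric])
  have "(1 - 2*l) / (2 * s ^ 3) * H + 2 * ((2*l - 1) / (4 * s ^ 3)) * H = 0"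
    using s by (simp add: field_simps)
  with Ab sum have "(A' * F + (F' * b') * ?A l) +
      ((2 * ((2*l - 1) / (4 * s ^ 3))) * H + (1/6 * (5/6) * F * b') * (2 * s)) = pulled_back l / 4"
    by linarith
  with D show ?thesis by (simp only:)
qed

lemma hyp2F1_sextic:
  assumes l: "0 \<le> l" "l < 1"
  shows "hyp2F1 (1/6) (5/6) 1 (beta_of l) = root_quad l * hyp2F1 (1/2) (1/2) 1 l"
proof -
  let ?y = "hyp2F1 (1/2) (1/2) 1"
  let ?y' = "hyp_deriv (1/2) (1/2)"
  let ?N = "\<lambda>l. l * (1 - l) * ?y' l"
  \<comment> \<open>$l(1-l)$ times the Wronskian, so it is constant and vanishes at $0$\<close>
  let ?W = "\<lambda>l. pulled_back_flux l * ?y l - pulled_back l * ?N l"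
  have y: "(?y has_real_derivative ?y' x) (at x)" if "0 \<le> x" "x < 1" for x
    using that by (intro hyp2F1_has_real_derivative) auto
  have N: "(?N has_real_derivative 1/2 * (1/2) * ?y x) (at x)" if "0 \<le> x" "x < 1" for x
    using that by (intro hyp2F1_ode) auto
  have W: "(?W has_real_derivative 0) (at x)" if x: "0 \<le> x" "x < 1" for x
  proof -
    obtain D where D: "(pulled_back has_real_derivative D) (at x)" "x * (1 - x) * D = pulled_back_flux x"
      using pulled_back_has_real_derivative[OF x] .
    have "(?W has_real_derivative
        (pulled_back_flux x * ?y' x + pulled_back x / 4 * ?y x)
        - (pulled_back x * (1/2 * (1/2) * ?y x) + D * ?N x)) (at x)"
      by (intro DERIV_diff DERIV_mult' pulled_back_flux_has_real_derivative N y D(1) x)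
    \<comment> \<open>With the flux written as x(1 - x)D the two cross terms cancel, and the other
      two agree because both equations have eigenvalue 1/4.\<close>
    then show ?thesis unfolding D(2)[symmetric] by (simp add: algebra_simps)
  qed
  have W0: "?W x = 0" if x: "0 < x" "x < 1" for x
  proof -
    have "?W x = ?W 0"
      by (rule DERIV_isconst_end[OF x(1)])
         (use x in \<open>auto intro!: W DERIV_continuous_on[where D="\<lambda>_. 0"] DERIV_subset[OF W]\<close>)
    also have "\<dots> = 0" by (simp add: pulled_back_flux_def beta_of_0)
    finally show ?thesis .
  qed
  let ?Q = "\<lambda>l. pulled_back l / ?y l"
  have ypos: "?y x \<noteq> 0" if "0 \<le> x" "x < 1" for x
    using hyp2F1_ge_1[of "1/2" "1/2" x] that by auto
  have cont: "isCont ?Q x" if x: "0 \<le> x" "x < 1" for x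
  proof -
    obtain D where D: "(pulled_back has_real_derivative D) (at x)"
      using pulled_back_has_real_derivative[OF x] .
    show ?thesis
      by (intro isCont_divide DERIV_isCont[OF D] DERIV_isCont[OF y] x ypos)
  qed
  \<comment> \<open>The vanishing Wronskian gives Q' = 0 after cancelling x(1 - x), hence only for x
    > 0; continuity then links Q to its value 1 at 0.\<close>
  have Q: "(?Q has_real_derivative 0) (at x)" if x: "0 < x" "x < 1" for x
  proof -
    obtain D where D: "(pulled_back has_real_derivative D) (at x)" "x * (1 - x) * D = pulled_back_flux x"
      using pulled_back_has_real_derivative[of x] x by auto
    have "x * (1 - x) * (D * ?y x - pulled_back x * ?y' x) = 0"
      using W0[OF x] unfolding D(2)[symmetric] by (simp add: algebra_simps)
    then have "D * ?y x - pulled_back x * ?y' x = 0" using x by simp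
    moreover have "(?Q has_real_derivative (D * ?y x - pulled_back x * ?y' x) / (?y x * ?y x)) (at x)"
      using x by (intro DERIV_divide D(1) y ypos) auto
    ultimately show ?thesis by simp
  qed
  have "?Q l = 1"
  proof (cases "l = 0")
    case True
    then show ?thesis
      by (simp add: pulled_back_def beta_of_0 hyp2F1_0 root_quad_def quad_def)
  next
    case False
    have "?Q l = ?Q 0"
      by (rule DERIV_isconst_end)
         (use False l in \<open>auto intro!: Q continuous_at_imp_continuous_on cont\<close>)
    also have "\<dots> = 1"
      by (simp add: pulled_back_def beta_of_0 hyp2F1_0 root_quad_def quad_def)
    finally show ?thesis .
  qed
  then show ?thesis
    using ypos[OF l] root_quad_pos[of l] by (simp add: pulled_back_def field_simps)
qed

text \<open>The contiguous relation expresses both quotients through first derivatives, and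
  differentiating the sextic transformation relates these to each other. What remains is an identity
  in l, s, y and y'.\<close>

lemma hyp2F1_sextic_log_derivative:
  assumes l: "0 < l" "l < 1"
  shows "10 * (1 - hyp2F1 (-5/6) (5/6) 1 (beta_of l) / hyp2F1 (1/6) (5/6) 1 (beta_of l))
    = 1 + 8 * beta_of l - (1 + l) / sqrt (quad l)
      + 3 * (1 - hyp2F1 (-1/2) (1/2) 1 l / hyp2F1 (1/2) (1/2) 1 l) / sqrt (quad l)"
proof -
  define s where "s = root_quad l"
  have s: "s \<noteq> 0" using root_quad_pos[of l] by (simp add: s_def)
  have p: "s ^ 4 = 1 - l + l\<^sup>2" using root_quad_pow4[of l] by (simp add: s_def quad_def)
  have sq: "sqrt (quad l) = s ^ 2" by (simp add: s_def root_quad_sq)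
  define b where "b = beta_of l"
  define F' where "F' = hyp_deriv (1/6) (5/6) b"
  define y where "y = hyp2F1 (1/2) (1/2) 1 l"
  define y' where "y' = hyp_deriv (1/2) (1/2) l"
  define b' where "b' = 27 * l * (1 - l) / (8 * s ^ 10)"
  define B where "B = b * (1 - b) * F'"
  have y: "y \<noteq> 0" using hyp2F1_ge_1[of "1/2" "1/2" l] l by (simp add: y_def)
  have F: "hyp2F1 (1/6) (5/6) 1 b = s * y"
    using hyp2F1_sextic[of l] l by (simp add: b_def s_def y_def)
  have b1: "\<bar>b\<bar> < 1" using beta_of_bounds[OF l] by (simp add: b_def)
  have E6: "hyp2F1 (-5/6) (5/6) 1 b = 6/5 * B + (1 - b) * s * y"
    using hyp2F1_contiguous[of "1/6" "5/6" b] b1 by (simp add: F B_def F'_def field_simps)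
  have E2: "hyp2F1 (-1/2) (1/2) 1 l = 2 * (l * (1 - l)) * y' + (1 - l) * y"
    using hyp2F1_contiguous[of "1/2" "1/2" l] l by (simp add: y_def y'_def field_simps)
  \<comment> \<open>Two derivatives of one function: by the chain rule, and by the product rule
    after the sextic transformation.\<close>
  have d: "F' * b' = (2*l - 1) / (4 * s ^ 3) * y + y' * s"
  proof (rule DERIV_unique)
    show "((\<lambda>l. hyp2F1 (1/6) (5/6) 1 (beta_of l)) has_real_derivative F' * b') (at l)"
      unfolding F'_def b_def b'_def s_def
      by (rule hyp2F1_beta_of_has_real_derivative) (use l in auto)
    show "((\<lambda>l. hyp2F1 (1/6) (5/6) 1 (beta_of l)) has_real_derivative
        (2*l - 1) / (4 * s ^ 3) * y + y' * s) (at l)"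
    proof (rule has_field_derivative_transform_within_open)
      show "((\<lambda>l. root_quad l * hyp2F1 (1/2) (1/2) 1 l) has_real_derivative
        (2*l - 1) / (4 * s ^ 3) * y + y' * s) (at l)"
        unfolding s_def y_def y'_def
        by (intro DERIV_mult root_quad_has_real_derivative hyp2F1_has_real_derivative) (use l in auto)
      show "open {0<..<1::real}" "l \<in> {0<..<1}" using l by auto
    qed (simp add: hyp2F1_sextic)
  qed
  have "2 * s ^ 2 * B = l * (1 - l) * (F' * b')"
  proof -
    have "l * (1 - l) * b' = 2 * s ^ 2 * (b * (1 - b))"
      using beta_of_deriv_mult[of l] by (simp add: b_def b'_def s_def)
    then have "l * (1 - l) * b' * F' = 2 * s ^ 2 * (b * (1 - b)) * F'" by simp
    then show ?thesis by (simp only: B_def mult_ac)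
  qed
  then have "(2 * s ^ 2 * B) * (4 * s ^ 3) = l * (1 - l) * ((2*l - 1) / (4 * s ^ 3) * y + y' * s) * (4 * s ^ 3)"
    unfolding d by simp
  also have "\<dots> = l * (1 - l) * ((2*l - 1) * y + 4 * s ^ 4 * y')"
    using s by (simp add: field_simps eval_nat_numeral)
  also have "(2 * s ^ 2 * B) * (4 * s ^ 3) = 8 * (s ^ 5 * B)"
    by (simp add: eval_nat_numeral)
  finally have B: "8 * (s ^ 5 * B) = l * (1 - l) * ((2*l - 1) * y + 4 * s ^ 4 * y')" .
  have b: "2 * b * s ^ 6 = s ^ 6 - (1 + l) * (1 - l/2) * (1 - 2*l)"
    using s by (simp add: b_def beta_of_def s_def field_simps)
  \<comment> \<open>Multiplying both sides by 2 s^6 y clears all denominators. Substituting for 2 b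
    s^6 makes the pure s^6 terms cancel, and s^4 is polynomial in l.\<close>
  let ?L = "10 * b - 12 * B / (s * y)"
  let ?R = "1 + 8 * b - (1 + l) / s ^ 2 + 3 * (1 - (2 * (l * (1 - l)) * y' + (1 - l) * y) / y) / s ^ 2"
  have "?L * (2 * s ^ 6 * y) = 10 * (2 * b * s ^ 6) * y - 3 * (8 * (s ^ 5 * B))"
    using s y by (simp add: field_simps eval_nat_numeral)
  moreover have "?R * (2 * s ^ 6 * y) = 2 * s ^ 6 * y + 8 * (2 * b * s ^ 6) * y - 2 * (1 + l) * s ^ 4 * y
      + 6 * s ^ 4 * (y - (2 * (l * (1 - l)) * y' + (1 - l) * y))"
    using s y by (simp add: field_simps eval_nat_numeral)
  moreover have "10 * (2 * b * s ^ 6) * y - 3 * (8 * (s ^ 5 * B)) = 2 * s ^ 6 * y + 8 * (2 * b * s ^ 6) * y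
      - 2 * (1 + l) * s ^ 4 * y + 6 * s ^ 4 * (y - (2 * (l * (1 - l)) * y' + (1 - l) * y))"
    unfolding B b p by (simp add: field_simps) algebra
  ultimately have "?L * (2 * s ^ 6 * y) = ?R * (2 * s ^ 6 * y)" by (simp only:)
  then have "?L = ?R" using s y by simp
  moreover have "10 * (1 - (6/5 * B + (1 - b) * s * y) / (s * y)) = ?L"
    using s y by (simp add: field_simps)
  ultimately show ?thesis
    unfolding sq b_def[symmetric] E6 F E2 y_def[symmetric] by simp
qed

section \<open>Identification of the singular values and the final identity\<close>

lemma singular_modulus_eq:
  assumes l: "0 < l" "l < 1"
    and r: "hyp2F1 (1/2) (1/2) 1 (1 - l) / hyp2F1 (1/2) (1/2) 1 l = sqrt r"
  shows "singular_modulus r = sqrt l"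
proof -
  have K: "ellK (sqrt (1 - w\<^sup>2)) / ellK w
      = hyp2F1 (1/2) (1/2) 1 (1 - w\<^sup>2) / hyp2F1 (1/2) (1/2) 1 (w\<^sup>2)" if "0 < w" "w < 1" for w
  proof -
    \<comment> \<open>Both strict bounds matter: the series form of K is applied at w and at sqrt(1
      - w^2), each of which must be below 1.\<close>
    have "w\<^sup>2 < 1" using that by (simp add: abs_square_less_1)
    moreover have "0 < w\<^sup>2" using that by simp
    ultimately show ?thesis using that by (simp add: ellK_eq_hyp2F1)
  qed
  show ?thesis unfolding singular_modulus_def
  proof (rule the_equality)
    show "0 < sqrt l \<and> sqrt l < 1 \<and> ellK (sqrt (1 - (sqrt l)\<^sup>2)) / ellK (sqrt l) = sqrt r"
      using l r by (subst K) auto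
    fix w assume w: "0 < w \<and> w < 1 \<and> ellK (sqrt (1 - w\<^sup>2)) / ellK w = sqrt r"
    then have "w\<^sup>2 < 1" by (simp add: abs_square_less_1)
    moreover have "hyp2F1 (1/2) (1/2) 1 (1 - w\<^sup>2) / hyp2F1 (1/2) (1/2) 1 (w\<^sup>2)
        = hyp2F1 (1/2) (1/2) 1 (1 - l) / hyp2F1 (1/2) (1/2) 1 l"
      using K[of w] w r by metis
    ultimately have "w\<^sup>2 = l"
      using w l by (intro hyp2F1_ratio_unique[of "1/2" "1/2" "w\<^sup>2" l]) simp_all
    then show "w = sqrt l" using w by (metis abs_of_pos real_sqrt_abs)
  qed
qed

lemma beta_r_eq:
  assumes l: "0 < l" "l < 1"
    and r: "hyp2F1 (1/2) (1/2) 1 (1 - l) / hyp2F1 (1/2) (1/2) 1 l = sqrt r"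
  shows "beta_r r = beta_of l"
proof -
  \<comment> \<open>The factor \<open>root_quad\<close> is invariant under l -> 1 - l, so it drops
    out of the ratio.\<close>
  have b: "hyp2F1 (1/6) (5/6) 1 (1 - beta_of l) / hyp2F1 (1/6) (5/6) 1 (beta_of l) = sqrt r"
    unfolding beta_of_one_minus[symmetric] r[symmetric]
    using l root_quad_pos[of l] by (simp add: hyp2F1_sextic root_quad_one_minus)
  show ?thesis unfolding beta_r_def
  proof (rule the_equality)
    show "0 < beta_of l \<and> beta_of l < 1 \<and>
        hyp2F1 (1/6) (5/6) 1 (1 - beta_of l) / hyp2F1 (1/6) (5/6) 1 (beta_of l) = sqrt r"
      using b beta_of_bounds[OF l] by blast
    fix w assume w: "0 < w \<and> w < 1 \<and>
        hyp2F1 (1/6) (5/6) 1 (1 - w) / hyp2F1 (1/6) (5/6) 1 w = sqrt r"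
    show "w = beta_of l"
      by (rule hyp2F1_ratio_unique[of "1/6" "5/6"]) (use w b beta_of_bounds[OF l] in simp_all)
  qed
qed

theorem theorem3p2:
  fixes r :: real
  assumes "r > 0"
  shows "10 * alpha5 r * r powr (-1/2) =
    1 + 8 * beta_r r
    - (1 + (singular_modulus r)\<^sup>2 - 3 * elliptic_alpha r * r powr (-1/2))
      / sqrt (1 - (singular_modulus r)\<^sup>2 + (singular_modulus r) ^ 4)"
proof -
  obtain l where l: "0 < l" "l < 1"
    and ratio: "hyp2F1 (1/2) (1/2) 1 (1 - l) / hyp2F1 (1/2) (1/2) 1 l = sqrt r"
    using hyp2F1_ratio_surj[of "1/2" "1/2" "sqrt r"] assms by auto
  have k: "singular_modulus r = sqrt l" by (rule singular_modulus_eq[OF l ratio])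
  have b: "beta_r r = beta_of l" by (rule beta_r_eq[OF l ratio])
  define y where "y = hyp2F1 (1/2) (1/2) 1 l"
  define e where "e = hyp2F1 (-1/2) (1/2) 1 l / y"
  define e6 where "e6 = hyp2F1 (-5/6) (5/6) 1 (beta_of l) / hyp2F1 (1/6) (5/6) 1 (beta_of l)"
  define q where "q = sqrt (quad l)"
  define t where "t = sqrt r"
  have t: "t > 0" using assms by (simp add: t_def)
  have q: "q > 0" using quad_pos[of l] by (simp add: q_def)
  have F: "(hyp2F1 (1/6) (5/6) 1 (beta_of l))\<^sup>2 = q * y\<^sup>2"
    using l by (simp add: hyp2F1_sextic power_mult_distrib root_quad_sq q_def y_def)
  have y: "y \<noteq> 0" using hyp2F1_ge_1[of "1/2" "1/2" l] l by (simp add: y_def)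
  have main: "10 * (1 - e6) = 1 + 8 * beta_of l - (1 + l) / q + 3 * (1 - e) / q"
    using hyp2F1_sextic_log_derivative[OF l] by (simp add: e_def e6_def y_def q_def)
  have r: "r powr (-1/2) = 1 / t"
    using assms powr_minus_divide[of r "1/2"] by (simp add: powr_half_sqrt t_def)
  have a: "elliptic_alpha r = 1 / (pi * y\<^sup>2) - t * (e - 1)"
    using l by (simp add: elliptic_alpha_def Let_def k ellK_eq_hyp2F1 ellE_eq_hyp2F1 e_def
      y_def[symmetric] t_def power_mult_distrib power_divide power2_eq_square)
  have c: "cos (pi * (1/3)) = 1/2" using cos_60 by simp
  \<comment> \<open>The constant 3/10 is cos(pi/3) / (1 + 2/3).\<close>
  have a5: "alpha5 r = 3 / 10 * (1 / (pi * (q * y\<^sup>2))) - t * (e6 - 1)"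
    unfolding alpha5_def gen_alpha_def genK_def genE_def c F[symmetric]
    using beta_of_bounds[OF l]
    by (simp add: b e6_def t_def power_mult_distrib power2_eq_square)
  have "10 * alpha5 r * r powr (-1/2) = 3 / (pi * (q * y\<^sup>2) * t) + 10 * (1 - e6)"
    unfolding a5 r using t by (simp add: field_simps)
  \<comment> \<open>The term 3 / (pi q y^2 t) is the contribution of pi/(4 K^2) in a(r) on the
    right; the rest is \<open>main\<close>.\<close>
  also have "\<dots> = 1 + 8 * beta_of l - (1 + l - 3 * elliptic_alpha r * (1 / t)) / q"
    unfolding main a using t q y by (simp add: field_simps)
  also have "q = sqrt (1 - (singular_modulus r)\<^sup>2 + (singular_modulus r) ^ 4)"
  proof -
    have "(sqrt l) ^ 4 = ((sqrt l)\<^sup>2)\<^sup>2" by simp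
    then show ?thesis using l by (simp add: q_def quad_def k)
  qed
  also have "1 + l = 1 + (singular_modulus r)\<^sup>2" using l by (simp add: k)
  finally show ?thesis unfolding b r .
qed

end
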